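(* Let $\widehat{\alpha}$ be a plane curve in $\mathbb{D}^3$. If $\widehat{\beta}$ and $\widehat{\gamma}$ are involutes of $\widehat\alpha$, then $\widehat\beta$ and $\widehat\gamma$ are Bertrand curves in $\mathbb{D}^3$.
   Context: Dual numbers: $\mathbb{D}=\{\widehat a=a+\varepsilon a^*: a,a^*\in\mathbb{R}\}$ with $\varepsilon^2=0$, a commutative ring under $(a+\varepsilon a^* )+(b+\varepsilon b^* )=(a+b)+\varepsilon(a^*+b^* )$ and $(a+\varepsilon a^* )(b+\varepsilon b^* )=ab+\varepsilon(ab^*+ba^* )$. A dual number is pure-dual if its real part $a$ is $0$. $\mathbb{D}^3$ is the $\mathbb{D}$-module of dual vectors $\widehat a=a+\varepsilon a^*$ with $a,a^*\in\mathbb{R}^3$. Inner product: $\langle\widehat a,\widehat b\rangle=\langle a,b\rangle+\varepsilon(\langle a,b^*\rangle+\langle a^*,b\rangle)$. The cross product is given by the usual coordinate formula with dual entries. Norm: $\|\widehat a\|=\sqrt{\langle\widehat a,\widehat a\rangle}=\|a\|+\varepsilon\frac{\langle a,a^*\rangle}{\|a\|}$ for $a\neq0$. A dual space curve is a map $\widehat\alpha:I\subset\mathbb{D}\to\mathbb{D}^3$, $\widehat\alpha(s)=\alpha(s)+\varepsilon\alpha^*(s)$, with $\alpha,\alpha^*$ differentiable vector functions. With respect to its dual arc-length parameter, its Frenet frame $\{\widehat T,\widehat N,\widehat B\}$ (unit tangent, unit principal normal, $\widehat B=\widehat T\times\widehat N$), curvature $\widehat\kappa$ ($\mathbb{D}$-valued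 and nowhere pure-dual) and torsion $\widehat\tau$ ($\mathbb{D}$-valued) satisfy $\widehat T=\widehat\alpha'$, $\widehat T'=\widehat\kappa\widehat N$, $\widehat N'=-\widehat\kappa\widehat T+\widehat\tau\widehat B$, $\widehat B'=-\widehat\tau\widehat N$. All curves considered (including the involutes) are assumed regular enough for their Frenet frames to exist. A plane curve is one with $\widehat\tau(s)=0$ for all $s$. Involute: for $\widehat\alpha$ parameterized by arc length $s$ with unit tangent $\widehat T$, an involute of $\widehat\alpha$ is a curve $\widehat\beta(s)=\widehat\alpha(s)+(\widehat c-s)\widehat T(s)$ with $\widehat c\in\mathbb{D}$ constant. Points of two involutes of $\widehat\alpha$ correspond when they have the same parameter value $s$. Bertrand curves: two dual space curves are called Bertrand curves if there is a correspondence between their points such that their principal normal vectors at corresponding points are linearly dependent (each is a multiple of the other by a dual number). *)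

theory Defs
  imports "HOL-Analysis.Analysis"
begin

section \<open>Dual numbers\<close>

datatype dual = Dual (real_part: real) (dual_part: real)

lemma dual_eq_iff: "x = y \<longleftrightarrow> real_part x = real_part y \<and> dual_part x = dual_part y"
  by (cases x; cases y) auto

instantiation dual :: comm_ring_1
begin

definition "0 = Dual 0 0"
definition "1 = Dual 1 0"
definition "x + y = Dual (real_part x + real_part y) (dual_part x + dual_part y)"
definition "x - y = Dual (real_part x - real_part y) (dual_part x - dual_part y)"
definition "- x = Dual (- real_part x) (- dual_part x)"
definition "x * y =
  Dual (real_part x * real_part y) (real_part x * dual_part y + dual_part x * real_part y)"

instance
  by standard
    (simp_all add: dual_eq_iff zero_dual_def one_dual_def plus_dual_def minus_dual_def
      uminus_dual_def times_dual_def algebra_simps)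

end

lemma dual_parts [simp]:
  "real_part 0 = 0" "dual_part 0 = 0"
  "real_part 1 = 1" "dual_part 1 = 0"
  "real_part (x + y) = real_part x + real_part y"
  "dual_part (x + y) = dual_part x + dual_part y"
  "real_part (x - y) = real_part x - real_part y"
  "dual_part (x - y) = dual_part x - dual_part y"
  "real_part (- x) = - real_part x" "dual_part (- x) = - dual_part x"
  "real_part (x * y) = real_part x * real_part y"
  "dual_part (x * y) = real_part x * dual_part y + dual_part x * real_part y"
  by (simp_all add: zero_dual_def one_dual_def plus_dual_def minus_dual_def
      uminus_dual_def times_dual_def)

instantiation dual :: real_algebra_1
begin

definition "scaleR r x = Dual (r * real_part x) (r * dual_part x)"

instance
  by standard (simp_all add: dual_eq_iff scaleR_dual_def algebra_simps)

end

text \<open>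
  The norm below only serves to give the dual numbers their usual topology, that of the plane;
  the sum norm is chosen because, unlike the Euclidean one, it is submultiplicative. It has nothing
  to do with the dual-valued norm of dual vectors, which is \<open>dnorm\<close>.
\<close>

instantiation dual :: real_normed_algebra_1
begin
definition "norm x = \<bar>real_part x\<bar> + \<bar>dual_part x\<bar>"
definition "dist x y = norm (x - y)" for x y :: dual
definition "sgn x = x /\<^sub>R norm x" for x :: dual
definition "(uniformity :: (dual \<times> dual) filter) =
  (INF e\<in>{0<..}. principal {(x, y). dist x y < e})"
definition "open (U :: dual set) \<longleftrightarrow>
  (\<forall>x\<in>U. eventually (\<lambda>(x', y). x' = x \<longrightarrow> y \<in> U) uniformity)"

instance
proof
  fix x y :: dual and r s :: real
  show "norm (x * y) \<le> norm x * norm y"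
  proof -
    have "\<bar>real_part x * dual_part y + dual_part x * real_part y\<bar>
        \<le> \<bar>real_part x\<bar> * \<bar>dual_part y\<bar> + \<bar>dual_part x\<bar> * \<bar>real_part y\<bar>"
      by (metis abs_mult abs_triangle_ineq)
    then show ?thesis
      by (simp add: norm_dual_def abs_mult algebra_simps add_increasing)
  qed
  show "norm (x + y) \<le> norm x + norm y"
    using abs_triangle_ineq[of "real_part x" "real_part y"]
      abs_triangle_ineq[of "dual_part x" "dual_part y"]
    by (simp add: norm_dual_def)
  show "norm x = 0 \<longleftrightarrow> x = 0"
    by (auto simp: norm_dual_def dual_eq_iff)
qed (simp_all add: dual_eq_iff scaleR_dual_def norm_dual_def dist_dual_def sgn_dual_def
      uniformity_dual_def open_dual_def abs_mult algebra_simps)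

end

lemma of_real_dual: "of_real r = Dual r 0"
  by (simp add: of_real_def scaleR_dual_def)

definition pure_dual :: "dual \<Rightarrow> bool" where
  "pure_dual x \<longleftrightarrow> real_part x = 0"

definition dsqrt :: "dual \<Rightarrow> dual" where
  "dsqrt x = Dual (sqrt (real_part x)) (dual_part x / (2 * sqrt (real_part x)))"

lemma dsqrt_square:
  assumes "0 < real_part x"
  shows "dsqrt x * dsqrt x = x"
  using assms by (simp add: dsqrt_def dual_eq_iff)


section \<open>Dual vectors\<close>

text \<open>The module of dual vectors is \<open>dual ^ 3\<close>, with scalar multiplication \<open>(*s)\<close>.\<close>

definition real_vec :: "dual ^ 3 \<Rightarrow> real ^ 3" where
  "real_vec a = (\<chi> i. real_part (a $ i))"

definition dual_vec :: "dual ^ 3 \<Rightarrow> real ^ 3" where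
  "dual_vec a = (\<chi> i. dual_part (a $ i))"

definition dinner :: "dual ^ 3 \<Rightarrow> dual ^ 3 \<Rightarrow> dual" where
  "dinner a b =
    Dual (real_vec a \<bullet> real_vec b) (real_vec a \<bullet> dual_vec b + dual_vec a \<bullet> real_vec b)"

definition dnorm :: "dual ^ 3 \<Rightarrow> dual" where
  "dnorm a = dsqrt (dinner a a)"

definition dcross :: "dual ^ 3 \<Rightarrow> dual ^ 3 \<Rightarrow> dual ^ 3" where
  "dcross a b = vector [a $ 2 * b $ 3 - a $ 3 * b $ 2,
                        a $ 3 * b $ 1 - a $ 1 * b $ 3,
                        a $ 1 * b $ 2 - a $ 2 * b $ 1]"

definition dual_dependent :: "dual ^ 3 \<Rightarrow> dual ^ 3 \<Rightarrow> bool" where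
  "dual_dependent u v \<longleftrightarrow> (\<exists>c. u = c *s v) \<and> (\<exists>c. v = c *s u)"

lemma dinner_eq_sum: "dinner a b = (\<Sum>i\<in>UNIV. a $ i * b $ i)"
  by (simp add: dinner_def real_vec_def dual_vec_def inner_vec_def sum_3 dual_eq_iff)

lemma dnorm_eq:
  "dnorm a = Dual (norm (real_vec a)) (real_vec a \<bullet> dual_vec a / norm (real_vec a))"
  by (simp add: dnorm_def dsqrt_def dinner_def norm_eq_sqrt_inner inner_commute)


section \<open>Differentiation with respect to a dual parameter\<close>

text \<open>
  The derivative is the one over the ring of dual numbers:
  \<open>f (s + h) = f s + h *s d + o(h)\<close> for \<open>s + h\<close> in \<open>I\<close>. For \<open>I\<close> open these are the
  dual-analytic functions; for \<open>I\<close> an interval of the real line, \<open>d\<close> is the ordinary derivative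
  with respect to a real parameter. The arc length of a curve with real parameter is in general a
  properly dual-valued function, so it is a parameter ranging over a plane arc in the dual numbers.
\<close>

definition has_dual_derivative ::
    "(dual \<Rightarrow> dual ^ 3) \<Rightarrow> dual ^ 3 \<Rightarrow> dual \<Rightarrow> dual set \<Rightarrow> bool" where
  "has_dual_derivative f d s I \<longleftrightarrow> (f has_derivative (\<lambda>h. h *s d)) (at s within I)"

text \<open>
  The sets on which derivatives are unique. This rules out isolated points, and points that \<open>I\<close>
  approaches only in pure-dual directions, along which \<open>h * d\<close> does not see the dual part of \<open>d\<close>.
\<close>

definition parameter_domain :: "dual set \<Rightarrow> bool" where
  "parameter_domain I \<longleftrightarrow>
    (\<forall>s\<in>I. \<forall>d::dual. ((\<lambda>_. 0) has_derivative (\<lambda>h. h * d)) (at s within I) \<longrightarrow> d = 0)"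

lemma parameter_domain_open:
  assumes "open I"
  shows "parameter_domain I"
  unfolding parameter_domain_def
proof (intro ballI allI impI)
  fix s d :: dual
  assume "s \<in> I" and "((\<lambda>_. 0) has_derivative (\<lambda>h. h * d)) (at s within I)"
  then have "((\<lambda>_. 0::dual) has_derivative (\<lambda>h. h * d)) (at s)"
    using assms at_within_open by metis
  moreover have "((\<lambda>_. 0::dual) has_derivative (\<lambda>h. 0)) (at s)"
    by simp
  ultimately have "(\<lambda>h. h * d) = (\<lambda>h. 0)"
    by (rule has_derivative_unique)
  then show "d = 0"
    by (metis mult_1)
qed

lemma parameter_domain_real_interval:
  assumes "is_interval X" and "a \<in> X" and "b \<in> X" and "a < b"
  shows "parameter_domain (of_real ` X)"
  unfolding parameter_domain_def
proof (intro ballI allI impI)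
  fix s d :: dual
  assume "s \<in> of_real ` X"
    and der: "((\<lambda>_. 0) has_derivative (\<lambda>h. h * d)) (at s within of_real ` X)"
  then obtain t where t: "t \<in> X" "s = of_real t"
    by blast
  have "((of_real :: real \<Rightarrow> dual) has_derivative of_real) (at t within X)"
    by (simp add: bounded_linear_imp_has_derivative bounded_linear_of_real)
  from diff_chain_within[OF this der[unfolded t]]
  have "((\<lambda>_. 0::dual) has_vector_derivative d) (at t within X)"
    by (simp add: has_vector_derivative_def o_def scaleR_conv_of_real)
  moreover have "((\<lambda>_. 0::dual) has_vector_derivative 0) (at t within X)"
    by simp
  moreover have "at t within X \<noteq> bot"
  proof -
    have "\<not> X \<subseteq> {t}"
      using assms by auto
    moreover have "connected X"
      using assms(1) by (simp add: is_interval_connected)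
    ultimately show ?thesis
      using t connected_imp_perfect trivial_limit_within by blast
  qed
  ultimately show "d = 0"
    using vector_derivative_unique_within by blast
qed


section \<open>Frenet frames\<close>

definition unit_speed_frenet_frame ::
    "dual set \<Rightarrow> (dual \<Rightarrow> dual ^ 3) \<Rightarrow>
     (dual \<Rightarrow> dual ^ 3) \<Rightarrow> (dual \<Rightarrow> dual ^ 3) \<Rightarrow> (dual \<Rightarrow> dual ^ 3) \<Rightarrow>
     (dual \<Rightarrow> dual) \<Rightarrow> (dual \<Rightarrow> dual) \<Rightarrow> bool" where
  "unit_speed_frenet_frame I \<alpha> T N B \<kappa> \<tau> \<longleftrightarrow>
    (\<forall>s\<in>I.
      dnorm (T s) = 1 \<and> dnorm (N s) = 1 \<and> B s = dcross (T s) (N s) \<and> \<not> pure_dual (\<kappa> s) \<and>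
      has_dual_derivative \<alpha> (T s) s I \<and>
      has_dual_derivative T (\<kappa> s *s N s) s I \<and>
      has_dual_derivative N (- (\<kappa> s *s T s) + \<tau> s *s B s) s I \<and>
      has_dual_derivative B (- (\<tau> s *s N s)) s I)"

definition arc_length :: "dual set \<Rightarrow> (dual \<Rightarrow> dual ^ 3) \<Rightarrow> (dual \<Rightarrow> dual) \<Rightarrow> bool" where
  "arc_length I \<beta> \<phi> \<longleftrightarrow> inj_on \<phi> I \<and>
    (\<forall>s\<in>I. \<exists>d. has_dual_derivative \<beta> d s I \<and> real_vec d \<noteq> 0 \<and>
       (\<phi> has_derivative (\<lambda>h. h * dnorm d)) (at s within I))"

text \<open>
  A curve with an arbitrary parameter \<open>s\<close> inherits its frame from its reparametrization \<open>\<beta>'\<close> by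
  arc length \<open>\<phi> s\<close>.
\<close>

definition frenet_frame ::
    "dual set \<Rightarrow> (dual \<Rightarrow> dual ^ 3) \<Rightarrow>
     (dual \<Rightarrow> dual ^ 3) \<Rightarrow> (dual \<Rightarrow> dual ^ 3) \<Rightarrow> (dual \<Rightarrow> dual ^ 3) \<Rightarrow>
     (dual \<Rightarrow> dual) \<Rightarrow> (dual \<Rightarrow> dual) \<Rightarrow> bool" where
  "frenet_frame I \<beta> T N B \<kappa> \<tau> \<longleftrightarrow>
    (\<exists>\<phi> \<beta>' T' N' B' \<kappa>' \<tau>'.
      arc_length I \<beta> \<phi> \<and>
      unit_speed_frenet_frame (\<phi> ` I) \<beta>' T' N' B' \<kappa>' \<tau>' \<and>
      (\<forall>s\<in>I. \<beta> s = \<beta>' (\<phi> s) \<and> T s = T' (\<phi> s) \<and> N s = N' (\<phi> s) \<and> B s = B' (\<phi> s) \<and>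
        \<kappa> s = \<kappa>' (\<phi> s) \<and> \<tau> s = \<tau>' (\<phi> s)))"

definition principal_normal ::
    "dual set \<Rightarrow> (dual \<Rightarrow> dual ^ 3) \<Rightarrow> (dual \<Rightarrow> dual ^ 3) \<Rightarrow> bool" where
  "principal_normal I \<beta> N \<longleftrightarrow> (\<exists>T B \<kappa> \<tau>. frenet_frame I \<beta> T N B \<kappa> \<tau>)"

definition frenet_curve :: "dual set \<Rightarrow> (dual \<Rightarrow> dual ^ 3) \<Rightarrow> bool" where
  "frenet_curve I \<beta> \<longleftrightarrow> (\<exists>T N B \<kappa> \<tau>. frenet_frame I \<beta> T N B \<kappa> \<tau>)"

definition unit_speed_plane_curve :: "dual set \<Rightarrow> (dual \<Rightarrow> dual ^ 3) \<Rightarrow> bool" where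
  "unit_speed_plane_curve I \<alpha> \<longleftrightarrow>
    (\<exists>T N B \<kappa> \<tau>. unit_speed_frenet_frame I \<alpha> T N B \<kappa> \<tau> \<and> (\<forall>s\<in>I. \<tau> s = 0))"


section \<open>Involutes and Bertrand curves\<close>

definition involute :: "dual set \<Rightarrow> (dual \<Rightarrow> dual ^ 3) \<Rightarrow> (dual \<Rightarrow> dual ^ 3) \<Rightarrow> bool" where
  "involute I \<alpha> \<beta> \<longleftrightarrow>
    (\<exists>T c. \<forall>s\<in>I. has_dual_derivative \<alpha> (T s) s I \<and> dnorm (T s) = 1 \<and>
       \<beta> s = \<alpha> s + (c - s) *s T s)"

text \<open>
  Principal normals are determined up to sign only, since the curvature may have either sign; this
  does not affect dependence over the dual numbers.
\<close>

definition bertrand_under ::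
    "(dual \<Rightarrow> dual) \<Rightarrow> dual set \<Rightarrow> (dual \<Rightarrow> dual ^ 3) \<Rightarrow> dual set \<Rightarrow> (dual \<Rightarrow> dual ^ 3) \<Rightarrow> bool"
  where
  "bertrand_under h I \<beta> J \<gamma> \<longleftrightarrow>
    frenet_curve I \<beta> \<and> frenet_curve J \<gamma> \<and> bij_betw h I J \<and>
    (\<forall>N M. principal_normal I \<beta> N \<longrightarrow> principal_normal J \<gamma> M \<longrightarrow>
       (\<forall>s\<in>I. dual_dependent (N s) (M (h s))))"

definition bertrand_curves ::
    "dual set \<Rightarrow> (dual \<Rightarrow> dual ^ 3) \<Rightarrow> dual set \<Rightarrow> (dual \<Rightarrow> dual ^ 3) \<Rightarrow> bool" where
  "bertrand_curves I \<beta> J \<gamma> \<longleftrightarrow> (\<exists>h. bertrand_under h I \<beta> J \<gamma>)"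

end

theory Submission
  imports Defs
begin

text \<open>
  If \<open>\<alpha>\<close> is a plane curve and \<open>\<beta> = \<alpha> + (c - s) T\<close>, then \<open>\<beta>' = T - T + (c - s) \<kappa> N = (c - s) \<kappa> N\<close>,
  so the unit tangent of \<open>\<beta>\<close> is \<open>\<plusminus>N\<close>, with the sign of the real part of \<open>(c - s) \<kappa>\<close>.
  Since the torsion vanishes, \<open>N' = - \<kappa> T\<close>, and therefore the principal normal of \<open>\<beta>\<close> is an
  invertible multiple of \<open>T\<close> (lemma \<open>principal_normal_of_plane_involute\<close>). The constant \<open>c\<close> has
  disappeared: the principal normals of any two involutes are invertible multiples of one and the
  same vector \<open>T s\<close>, hence of each other.

  Two points need care. First, invertibility: a dual number is a unit exactly if it is not
  pure-dual, and the factors that have to be cancelled (speed and curvature of \<open>\<beta>\<close>) are units by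
  regularity. Second, the sign \<open>\<plusminus>\<close> is a function of the parameter on a set that need not be
  connected, so it cannot be taken constant before differentiating. It is locally constant,
  because unit vectors stay away from their negatives; the lemma
  \<open>has_dual_derivative_eq_up_to_sign\<close> turns this into a statement about derivatives.
\<close>

section \<open>Units and unit vectors\<close>

lemma dual_inverse_exists:
  assumes "\<not> pure_dual x"
  obtains y where "\<not> pure_dual y" and "y * x = 1"
proof
  show "\<not> pure_dual (Dual (1 / real_part x) (- dual_part x / (real_part x)\<^sup>2))"
    using assms by (simp add: pure_dual_def)
  show "Dual (1 / real_part x) (- dual_part x / (real_part x)\<^sup>2) * x = 1"
    using assms by (simp add: pure_dual_def dual_eq_iff power2_eq_square)
qed

lemma pure_dual_mult_iff [simp]: "pure_dual (x * y) \<longleftrightarrow> pure_dual x \<or> pure_dual y"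
  by (simp add: pure_dual_def)

lemma pure_dual_minus_iff [simp]: "pure_dual (- x) \<longleftrightarrow> pure_dual x"
  by (simp add: pure_dual_def)

lemma dual_scale_cancel:
  assumes "\<not> pure_dual x" and "x *s u = x *s v"
  shows "u = v"
proof -
  obtain y where "y * x = 1"
    using assms(1) by (rule dual_inverse_exists)
  then show ?thesis
    by (metis assms(2) vector_smult_assoc vector_smult_lid)
qed

lemma vector_smult_minus_left: "(- x) *s v = - (x *s v)" for x :: dual and v :: "dual ^ 'n"
  by (simp add: vec_eq_iff)

lemma dual_dependent_unit_multiples:
  assumes "\<not> pure_dual x" and "\<not> pure_dual y"
  shows "dual_dependent (x *s v) (y *s v)"
proof -
  obtain x' y' where "x' * x = 1" and "y' * y = 1"
    using assms by (meson dual_inverse_exists)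
  then have "x *s v = (x * y') *s (y *s v)" and "y *s v = (y * x') *s (x *s v)"
    by (simp_all add: vector_smult_assoc mult.assoc)
  then show ?thesis
    unfolding dual_dependent_def by blast
qed

text \<open>
  Scaling by \<open>x\<close> multiplies the dual norm by \<open>\<bar>x\<bar>\<close>, that is, by \<open>x\<close> or \<open>- x\<close> according to the sign
  of the real part.
\<close>

lemma dnorm_scale_unit_vector:
  assumes "dnorm N = 1" and "\<not> pure_dual x"
  shows "dnorm (x *s N) = x \<or> dnorm (x *s N) = - x"
proof -
  let ?n = "real_vec N" and ?m = "dual_vec N"
  have n: "norm ?n = 1" and nm: "?n \<bullet> ?m = 0"
    using assms(1) by (auto simp: dnorm_eq dual_eq_iff)
  have nn: "?n \<bullet> ?n = 1"
    using n by (simp add: norm_eq_1)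
  have "real_vec (x *s N) = real_part x *\<^sub>R ?n"
    and "dual_vec (x *s N) = real_part x *\<^sub>R ?m + dual_part x *\<^sub>R ?n"
    by (simp_all add: real_vec_def dual_vec_def vec_eq_iff)
  then have "dnorm (x *s N) =
      Dual \<bar>real_part x\<bar> (real_part x * dual_part x / \<bar>real_part x\<bar>)"
    by (simp add: dnorm_eq n nm nn inner_add_right)
  with assms(2) show ?thesis
    by (auto simp: pure_dual_def dual_eq_iff abs_if)
qed

lemma not_pure_dual_dnorm: "real_vec d \<noteq> 0 \<Longrightarrow> \<not> pure_dual (dnorm d)"
  by (simp add: pure_dual_def dnorm_eq)

lemma real_vec_pure_dual_scale: "pure_dual x \<Longrightarrow> real_vec (x *s v) = 0"
  by (simp add: pure_dual_def real_vec_def vec_eq_iff)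

lemma norm_ge_1_if_dnorm_eq_1:
  assumes "dnorm v = 1"
  shows "1 \<le> norm v"
proof -
  have "norm (real_vec v) \<le> norm v"
    unfolding norm_vec_def by (rule L2_set_mono) (simp_all add: real_vec_def norm_dual_def)
  moreover have "norm (real_vec v) = 1"
    using assms by (simp add: dnorm_eq dual_eq_iff)
  ultimately show ?thesis
    by simp
qed

section \<open>Differentiation over the dual numbers\<close>

lemma bounded_bilinear_dual_scale:
  "bounded_bilinear ((*s) :: dual \<Rightarrow> dual ^ 'n \<Rightarrow> dual ^ 'n)"
proof
  fix a b :: dual and u v :: "dual ^ 'n" and r :: real
  show "(a + b) *s v = a *s v + b *s v" "a *s (u + v) = a *s u + a *s v"
    by (simp_all add: vec_eq_iff algebra_simps)
  show "(r *\<^sub>R a) *s v = r *\<^sub>R (a *s v)" "a *s (r *\<^sub>R v) = r *\<^sub>R (a *s v)"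
    by (simp_all add: vec_eq_iff)
  have "norm (a *s v) \<le> norm a * norm v" for a and v :: "dual ^ 'n"
    unfolding norm_vec_def
    by (subst L2_set_right_distrib) (auto intro!: L2_set_mono norm_mult_ineq)
  then show "\<exists>K. \<forall>a (v :: dual ^ 'n). norm (a *s v) \<le> norm a * norm v * K"
    by (intro exI[of _ 1]) simp
qed

lemma has_dual_derivative_cong:
  assumes "has_dual_derivative f d s I" and "s \<in> I" and "\<And>t. t \<in> I \<Longrightarrow> f t = g t"
  shows "has_dual_derivative g d s I"
  using has_derivative_transform[OF assms(2), of g f] assms(1,3)
  unfolding has_dual_derivative_def by simp

lemma has_dual_derivative_add:
  assumes "has_dual_derivative f d s I" and "has_dual_derivative g e s I"
  shows "has_dual_derivative (\<lambda>t. f t + g t) (d + e) s I"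
  using has_derivative_add[OF assms[unfolded has_dual_derivative_def]]
  unfolding has_dual_derivative_def by (simp add: vector_add_ldistrib)

lemma has_dual_derivative_minus:
  assumes "has_dual_derivative f d s I"
  shows "has_dual_derivative (\<lambda>t. - f t) (- d) s I"
proof -
  have "h *s (- d) = - (h *s d)" for h
    by (simp add: vec_eq_iff)
  then show ?thesis
    using has_derivative_minus[OF assms[unfolded has_dual_derivative_def]]
    unfolding has_dual_derivative_def by simp
qed

lemma has_dual_derivative_diff:
  assumes "has_dual_derivative f d s I" and "has_dual_derivative g e s I"
  shows "has_dual_derivative (\<lambda>t. f t - g t) (d - e) s I"
  using has_dual_derivative_add[OF assms(1) has_dual_derivative_minus[OF assms(2)]] by simp

lemma has_dual_derivative_scale:
  assumes "(x has_derivative (\<lambda>h. h * y)) (at s within I)" and "has_dual_derivative f d s I"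
  shows "has_dual_derivative (\<lambda>t. x t *s f t) (x s *s d + y *s f s) s I"
proof -
  have "(\<lambda>h. x s *s (h *s d) + (h * y) *s f s) = (\<lambda>h. h *s (x s *s d + y *s f s))"
    by (simp add: fun_eq_iff vec_eq_iff algebra_simps)
  with bounded_bilinear.FDERIV[OF bounded_bilinear_dual_scale assms(1)
      assms(2)[unfolded has_dual_derivative_def]]
  show ?thesis
    unfolding has_dual_derivative_def by simp
qed

lemma has_dual_derivative_chain:
  assumes "(\<phi> has_derivative (\<lambda>h. h * v)) (at s within I)"
    and "has_dual_derivative f d (\<phi> s) (\<phi> ` I)"
  shows "has_dual_derivative (\<lambda>t. f (\<phi> t)) (v *s d) s I"
  using diff_chain_within[OF assms(1) assms(2)[unfolded has_dual_derivative_def]]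
  unfolding has_dual_derivative_def by (simp add: o_def vector_smult_assoc)

lemma has_dual_derivative_zero_unique:
  assumes "parameter_domain I" and "s \<in> I" and "has_dual_derivative (\<lambda>_. 0) d s I"
  shows "d = 0"
proof -
  have "d $ i = 0" for i
  proof -
    have "((\<lambda>_. (0 :: dual ^ 3) $ i) has_derivative (\<lambda>h. (h *s d) $ i)) (at s within I)"
      using bounded_linear.has_derivative[OF bounded_linear_vec_nth]
        assms(3)[unfolded has_dual_derivative_def] by blast
    then show ?thesis
      using assms(1,2) unfolding parameter_domain_def by simp
  qed
  then show ?thesis
    by (simp add: vec_eq_iff)
qed

lemma has_dual_derivative_unique:
  assumes "parameter_domain I" and "s \<in> I"
    and "has_dual_derivative f d s I" and "has_dual_derivative f e s I"
  shows "d = e"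
  using has_dual_derivative_zero_unique[OF assms(1,2), of "d - e"]
    has_dual_derivative_diff[OF assms(3,4)] by simp

text \<open>
  If \<open>f = \<plusminus>g\<close> with a sign that may vary, then near a point where \<open>f = g\<close> the difference \<open>f - g\<close>
  is small by continuity, whereas \<open>f = - g\<close> would make its norm at least \<open>2\<close>. So \<open>f\<close> and \<open>g\<close> agree
  near that point.
\<close>

lemma has_dual_derivative_eq_of_eq_at:
  assumes "parameter_domain I" and "s \<in> I"
    and f: "has_dual_derivative f d s I" and g: "has_dual_derivative g e s I"
    and sgn: "\<And>t. t \<in> I \<Longrightarrow> f t = g t \<or> f t = - g t"
    and ge_1: "\<And>t. t \<in> I \<Longrightarrow> 1 \<le> norm (g t)"
    and at_s: "f s = g s"
  shows "d = e"
proof -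
  have diff: "has_dual_derivative (\<lambda>t. f t - g t) (d - e) s I"
    using f g by (rule has_dual_derivative_diff)
  then have "((\<lambda>t. f t - g t) \<longlongrightarrow> 0) (at s within I)"
    using has_derivative_continuous at_s
    unfolding has_dual_derivative_def continuous_within by fastforce
  from tendstoD[OF this, of 2] have "\<forall>\<^sub>F t in at s within I. norm (f t - g t) < 2"
    by simp
  moreover have "\<forall>\<^sub>F t in at s within I. t \<in> I"
    by (simp add: eventually_at_filter)
  ultimately have "\<forall>\<^sub>F t in at s within I. f t - g t = 0"
  proof eventually_elim
    case (elim t)
    show ?case
    proof (rule ccontr)
      assume "f t - g t \<noteq> 0"
      then have "f t - g t = (- 2) *\<^sub>R g t"
        using sgn[OF \<open>t \<in> I\<close>] by (auto simp: scaleR_2)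
      then show False
        using elim(1) ge_1[OF \<open>t \<in> I\<close>] by simp
    qed
  qed
  then have "has_dual_derivative (\<lambda>_. 0) (d - e) s I"
    using diff at_s \<open>s \<in> I\<close> unfolding has_dual_derivative_def
    by (auto elim: has_derivative_transform_eventually)
  then show ?thesis
    using has_dual_derivative_zero_unique[OF assms(1,2)] by fastforce
qed

lemma has_dual_derivative_eq_up_to_sign:
  assumes "parameter_domain I" and "s \<in> I"
    and f: "has_dual_derivative f d s I" and g: "has_dual_derivative g e s I"
    and sgn: "\<And>t. t \<in> I \<Longrightarrow> f t = g t \<or> f t = - g t"
    and ge_1: "\<And>t. t \<in> I \<Longrightarrow> 1 \<le> norm (g t)"
  shows "d = e \<or> d = - e"
proof (cases "f s = g s")
  case True
  then show ?thesis
    using has_dual_derivative_eq_of_eq_at[OF assms] by blast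
next
  case False
  then have "f s = - g s"
    using sgn[OF \<open>s \<in> I\<close>] by blast
  then have "d = - e"
    using has_dual_derivative_eq_of_eq_at[OF assms(1,2) f has_dual_derivative_minus[OF g]]
      sgn ge_1 by fastforce
  then show ?thesis ..
qed

section \<open>Principal normals of involutes\<close>

text \<open>
  The equations \<open>\<beta>' = T\<close> and \<open>T' = \<kappa> N\<close>, transported from arc length to an arbitrary parameter;
  the speed \<open>dnorm d\<close> enters by the chain rule.
\<close>

lemma frenet_frame_tangent:
  assumes "parameter_domain I" and "frenet_frame I \<beta> T N B \<kappa> \<tau>"
    and "s \<in> I" and "has_dual_derivative \<beta> d s I"
  shows "real_vec d \<noteq> 0" and "d = dnorm d *s T s" and "\<not> pure_dual (\<kappa> s)"
    and "has_dual_derivative T ((dnorm d * \<kappa> s) *s N s) s I"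
proof -
  obtain \<phi> \<beta>' T' N' B' \<kappa>' \<tau>' where arc: "arc_length I \<beta> \<phi>"
    and frame: "unit_speed_frenet_frame (\<phi> ` I) \<beta>' T' N' B' \<kappa>' \<tau>'"
    and eq: "\<And>t. t \<in> I \<Longrightarrow> \<beta> t = \<beta>' (\<phi> t) \<and> T t = T' (\<phi> t) \<and> N t = N' (\<phi> t) \<and> \<kappa> t = \<kappa>' (\<phi> t)"
    using assms(2) unfolding frenet_frame_def by blast
  have "\<exists>d. has_dual_derivative \<beta> d s I \<and> real_vec d \<noteq> 0 \<and>
      (\<phi> has_derivative (\<lambda>h. h * dnorm d)) (at s within I)"
    using arc \<open>s \<in> I\<close> unfolding arc_length_def by blast
  then have d: "real_vec d \<noteq> 0" "(\<phi> has_derivative (\<lambda>h. h * dnorm d)) (at s within I)"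
    using has_dual_derivative_unique[OF assms(1,3,4)] by blast+
  show "real_vec d \<noteq> 0"
    by (rule d(1))
  have at: "\<not> pure_dual (\<kappa>' (\<phi> s))"
      "has_dual_derivative \<beta>' (T' (\<phi> s)) (\<phi> s) (\<phi> ` I)"
      "has_dual_derivative T' (\<kappa>' (\<phi> s) *s N' (\<phi> s)) (\<phi> s) (\<phi> ` I)"
    using frame \<open>s \<in> I\<close> unfolding unit_speed_frenet_frame_def by blast+
  show "\<not> pure_dual (\<kappa> s)"
    using at(1) eq[OF \<open>s \<in> I\<close>] by simp
  have "has_dual_derivative \<beta> (dnorm d *s T s) s I"
    using has_dual_derivative_cong[OF has_dual_derivative_chain[OF d(2) at(2)] \<open>s \<in> I\<close>, of \<beta>] eq
      \<open>s \<in> I\<close> by simp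
  then show "d = dnorm d *s T s"
    by (rule has_dual_derivative_unique[OF assms(1,3,4)])
  show "has_dual_derivative T ((dnorm d * \<kappa> s) *s N s) s I"
    using has_dual_derivative_cong[OF has_dual_derivative_chain[OF d(2) at(3)] \<open>s \<in> I\<close>, of T] eq
      \<open>s \<in> I\<close> by (simp add: vector_smult_assoc)
qed

text \<open>
  The tangential terms \<open>T\<close> and \<open>- T\<close> of the derivative of \<open>\<alpha> + (c - s) T\<close> cancel, which is why
  an involute moves in the direction of the normal of \<open>\<alpha>\<close>.
\<close>

lemma involute_derivative:
  assumes "parameter_domain I" and "unit_speed_frenet_frame I \<alpha> T N B \<kappa> \<tau>" and "involute I \<alpha> \<beta>"
  obtains c where "\<And>s. s \<in> I \<Longrightarrow> has_dual_derivative \<beta> (((c - s) * \<kappa> s) *s N s) s I"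
proof -
  from assms(3) obtain U c
    where U: "\<And>t. t \<in> I \<Longrightarrow> has_dual_derivative \<alpha> (U t) t I \<and> \<beta> t = \<alpha> t + (c - t) *s U t"
    unfolding involute_def by blast
  have frame: "has_dual_derivative \<alpha> (T t) t I" "has_dual_derivative T (\<kappa> t *s N t) t I"
    if "t \<in> I" for t
    using assms(2) that unfolding unit_speed_frenet_frame_def by blast+
  have \<beta>: "\<alpha> t + (c - t) *s T t = \<beta> t" if "t \<in> I" for t
    using U[OF that] has_dual_derivative_unique[OF assms(1) that _ frame(1)[OF that]] by auto
  have "has_dual_derivative \<beta> (((c - s) * \<kappa> s) *s N s) s I" if "s \<in> I" for s
  proof -
    have "((\<lambda>t. c - t) has_derivative (\<lambda>h. h * (- 1))) (at s within I)"
      by (auto intro!: derivative_eq_intros)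
    note has_dual_derivative_add[OF frame(1) has_dual_derivative_scale[OF this frame(2)],
        OF that that]
    also have "T s + ((c - s) *s (\<kappa> s *s N s) + (- 1) *s T s) = ((c - s) * \<kappa> s) *s N s"
      by (simp add: vec_eq_iff algebra_simps)
    finally show ?thesis
      by (rule has_dual_derivative_cong[OF _ that \<beta>])
  qed
  then show ?thesis
    by (rule that)
qed

lemma principal_normal_of_plane_involute:
  assumes dom: "parameter_domain I"
    and frame: "unit_speed_frenet_frame I \<alpha> T N B \<kappa> \<tau>" and plane: "\<forall>s\<in>I. \<tau> s = 0"
    and "involute I \<alpha> \<beta>" and "principal_normal I \<beta> M" and "s \<in> I"
  obtains x where "\<not> pure_dual x" and "M s = x *s T s"
proof -
  obtain U V k w where \<beta>_frame: "frenet_frame I \<beta> U M V k w"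
    using assms(5) unfolding principal_normal_def by blast
  obtain c where \<beta>': "\<And>t. t \<in> I \<Longrightarrow> has_dual_derivative \<beta> (((c - t) * \<kappa> t) *s N t) t I"
    using involute_derivative[OF dom frame assms(4)] by metis
  let ?d = "\<lambda>t. ((c - t) * \<kappa> t) *s N t"
  have N: "dnorm (N t) = 1" if "t \<in> I" for t
    using frame that unfolding unit_speed_frenet_frame_def by blast
  have \<kappa>: "\<not> pure_dual (\<kappa> s)"
    using frame \<open>s \<in> I\<close> unfolding unit_speed_frenet_frame_def by blast
  have N': "has_dual_derivative N (- (\<kappa> s *s T s)) s I"
  proof -
    have "has_dual_derivative N (- (\<kappa> s *s T s) + \<tau> s *s B s) s I"
      using frame \<open>s \<in> I\<close> unfolding unit_speed_frenet_frame_def by blast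
    then show ?thesis
      using plane \<open>s \<in> I\<close> by simp
  qed
  have U: "U t = N t \<or> U t = - N t" if "t \<in> I" for t
  proof -
    let ?x = "(c - t) * \<kappa> t"
    note tan = frenet_frame_tangent(1,2)[OF dom \<beta>_frame that \<beta>'[OF that]]
    have x: "\<not> pure_dual ?x"
      using tan(1) real_vec_pure_dual_scale by blast
    from dnorm_scale_unit_vector[OF N[OF that] this] show ?thesis
    proof
      assume "dnorm (?d t) = ?x"
      then have "?x *s U t = ?x *s N t"
        using tan(2) by simp
      then show ?thesis
        using dual_scale_cancel[OF x] by blast
    next
      assume "dnorm (?d t) = - ?x"
      then have "?x *s N t = (- ?x) *s U t"
        using tan(2) by simp
      also have "\<dots> = ?x *s (- U t)"
        by (simp add: vec_eq_iff)
      finally have "N t = - U t"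
        using dual_scale_cancel[OF x] by blast
      then show ?thesis
        by simp
    qed
  qed
  note at_s = frenet_frame_tangent[OF dom \<beta>_frame \<open>s \<in> I\<close> \<beta>'[OF \<open>s \<in> I\<close>]]
  \<comment> \<open>Comparing derivatives in \<open>U = \<plusminus>N\<close> gives \<open>?y *s M = \<plusminus>\<kappa> *s T\<close>, and \<open>?y\<close> can be cancelled.\<close>
  let ?y = "dnorm (?d s) * k s"
  have "\<not> pure_dual ?y"
    using not_pure_dual_dnorm[OF at_s(1)] at_s(3) by simp
  then obtain z where z: "\<not> pure_dual z" "z * ?y = 1"
    by (rule dual_inverse_exists)
  have "?y *s M s = - (\<kappa> s *s T s) \<or> ?y *s M s = - (- (\<kappa> s *s T s))"
    using has_dual_derivative_eq_up_to_sign[OF dom \<open>s \<in> I\<close> at_s(4) N' U] N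
      norm_ge_1_if_dnorm_eq_1 by blast
  then have "?y *s M s = (- \<kappa> s) *s T s \<or> ?y *s M s = \<kappa> s *s T s"
    by (simp only: vector_smult_minus_left minus_minus)
  then have "z *s (?y *s M s) = (z * (- \<kappa> s)) *s T s \<or> z *s (?y *s M s) = (z * \<kappa> s) *s T s"
    by (elim disjE) (simp_all only: vector_smult_assoc simp_thms)
  then have "M s = (z * (- \<kappa> s)) *s T s \<or> M s = (z * \<kappa> s) *s T s"
    by (simp only: vector_smult_assoc z(2) vector_smult_lid)
  moreover have "\<not> pure_dual (z * (- \<kappa> s))" "\<not> pure_dual (z * \<kappa> s)"
    using z(1) \<kappa> by simp_all
  ultimately show ?thesis
    using that by blast
qed

theorem theorem4:
  fixes I :: "dual set" and \<alpha> \<beta> \<gamma> :: "dual \<Rightarrow> dual ^ 3"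
  assumes "parameter_domain I"
    and "unit_speed_plane_curve I \<alpha>"
    and "involute I \<alpha> \<beta>" and "involute I \<alpha> \<gamma>"
    and "frenet_curve I \<beta>" and "frenet_curve I \<gamma>"
  shows "bertrand_curves I \<beta> I \<gamma> \<and> bertrand_under (\<lambda>s. s) I \<beta> I \<gamma>"
proof -
  obtain T N B \<kappa> \<tau>
    where frame: "unit_speed_frenet_frame I \<alpha> T N B \<kappa> \<tau>" "\<forall>s\<in>I. \<tau> s = 0"
    using assms(2) unfolding unit_speed_plane_curve_def by blast
  have "dual_dependent (M s) (M' s)"
    if M: "principal_normal I \<beta> M" and M': "principal_normal I \<gamma> M'" and "s \<in> I" for M M' s
  proof -
    obtain x where "\<not> pure_dual x" "M s = x *s T s"
      using assms(1) frame assms(3) M \<open>s \<in> I\<close> by (rule principal_normal_of_plane_involute)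
    moreover obtain y where "\<not> pure_dual y" "M' s = y *s T s"
      using assms(1) frame assms(4) M' \<open>s \<in> I\<close> by (rule principal_normal_of_plane_involute)
    ultimately show ?thesis
      using dual_dependent_unit_multiples by metis
  qed
  then have "bertrand_under (\<lambda>s. s) I \<beta> I \<gamma>"
    unfolding bertrand_under_def using assms(5,6) bij_betw_id[of I] by (simp add: id_def)
  then show ?thesis
    unfolding bertrand_curves_def by blast
qed

end
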